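(* Let $A$ be a real symmetric positive definite $n\times n$ matrix with an energy decomposition $\mathcal{E}$, let $\mathcal{P}=\{P_j\}_{j=1}^M$ be a partition of an orthonormal basis $\mathcal{V}$ of $\mathbb{R}^n$, and let $\{\underline{A}_{P_j}\}_{j=1}^M$ be the corresponding interior energies. For each $1\le j\le M$ let $\Phi_j$ be a subspace of $\mathrm{span}\{P_j\}$ such that $$\|x-P_{\Phi_j}x\|_2\le\epsilon\|x\|_{\underline{A}_{P_j}}\quad\text{for all }x\in\mathrm{span}\{P_j\},$$ for some constant $\epsilon$ (the same for all $j$). Then $$\|x-P_\Phi x\|_2\le\epsilon\|x\|_A\quad\text{for all }x\in\mathbb{R}^n,$$ where $\Phi=\bigoplus_{j}\Phi_j$.
   Context: An energy decomposition of $A$ is a finite family $\mathcal{E}=\{E_k\}_{k=1}^m$ of symmetric positive semidefinite $n\times n$ matrices with $A=\sum_{k=1}^m E_k$. For $E\in\mathcal{E}$, $v\in\mathcal{V}$ write $E\sim v$ if $v^TEv>0$, and let $\mathcal{N}(E;\mathcal{V})=\{v\in\mathcal{V}:E\sim v\}$. For $\mathcal{S}\subset\mathcal{V}$ write $E\in\mathcal{S}$ if $\mathcal{N}(E;\mathcal{V})\subset\mathcal{S}$. The interior energy of $\mathcal{S}$ is $\underline{A}_{\mathcal{S}}=\sum_{E\in\mathcal{S}}E$. A partition of $\mathcal{V}$ is a family of pairwise disjoint subsets $P_j\subset\mathcal{V}$ with $\bigcup_jP_j=\mathcal{V}$. For a symmetric positive semidefinite matrix $B$, $\|x\|_B=\sqrt{x^TBx}$.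 $P_\Theta$ denotes the Euclidean orthogonal projection onto a subspace $\Theta$.
   Formalization: The constant ε is assumed nonnegative; for negative ε the claim fails, e.g. when all interior energies vanish and each Φ_j equals span{P_j}, where the hypothesis reads 0 ≤ 0 but the conclusion reads 0 ≤ ε‖x‖_A. *)

theory Defs
  imports "HOL-Analysis.Analysis" "HOL-Library.Set_Algebras" "HOL-Library.Disjoint_Sets"
begin

definition sym_psd :: "real ^ 'n ^ 'n \<Rightarrow> bool" where
  "sym_psd B \<longleftrightarrow> transpose B = B \<and> (\<forall>x. x \<bullet> (B *v x) \<ge> 0)"

definition sym_pd :: "real ^ 'n ^ 'n \<Rightarrow> bool" where
  "sym_pd B \<longleftrightarrow> transpose B = B \<and> (\<forall>x. x \<noteq> 0 \<longrightarrow> x \<bullet> (B *v x) > 0)"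

text \<open>Families \<open>{E\<^sub>k}\<close>, \<open>k = 1..m\<close>, are functions on \<^typ>\<open>nat\<close> of which only the values on
  \<open>{1..m}\<close> matter; repetitions are allowed and counted with multiplicity.\<close>

definition energy_decomposition ::
    "real ^ 'n ^ 'n \<Rightarrow> nat \<Rightarrow> (nat \<Rightarrow> real ^ 'n ^ 'n) \<Rightarrow> bool" where
  "energy_decomposition A m E \<longleftrightarrow> (\<forall>k\<in>{1..m}. sym_psd (E k)) \<and> A = (\<Sum>k=1..m. E k)"

definition orthonormal_basis :: "(real ^ 'n) set \<Rightarrow> bool" where
  "orthonormal_basis V \<longleftrightarrow>
     pairwise orthogonal V \<and> (\<forall>v\<in>V. norm v = 1) \<and> independent V \<and> span V = UNIV"

definition touches :: "real ^ 'n ^ 'n \<Rightarrow> real ^ 'n \<Rightarrow> bool" where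
  "touches E v \<longleftrightarrow> v \<bullet> (E *v v) > 0"

definition neighbours :: "real ^ 'n ^ 'n \<Rightarrow> (real ^ 'n) set \<Rightarrow> (real ^ 'n) set" where
  "neighbours E V = {v \<in> V. touches E v}"

definition interior_energy ::
    "nat \<Rightarrow> (nat \<Rightarrow> real ^ 'n ^ 'n) \<Rightarrow> (real ^ 'n) set \<Rightarrow> (real ^ 'n) set \<Rightarrow> real ^ 'n ^ 'n" where
  "interior_energy m E V S = (\<Sum>k\<in>{k\<in>{1..m}. neighbours (E k) V \<subseteq> S}. E k)"

text \<open>Parts may be empty.\<close>

definition partition_of :: "(real ^ 'n) set \<Rightarrow> nat \<Rightarrow> (nat \<Rightarrow> (real ^ 'n) set) \<Rightarrow> bool" where
  "partition_of V M P \<longleftrightarrow> disjoint_family_on P {1..M} \<and> (\<Union>j\<in>{1..M}. P j) = V"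

definition energy_norm :: "real ^ 'n ^ 'n \<Rightarrow> real ^ 'n \<Rightarrow> real" where
  "energy_norm B x = sqrt (x \<bullet> (B *v x))"

definition orth_proj :: "(real ^ 'n) set \<Rightarrow> real ^ 'n \<Rightarrow> real ^ 'n" where
  "orth_proj T x = (THE y. y \<in> T \<and> x - y \<in> T\<^sup>\<bottom>)"

lemma orth_proj_ex1:
  fixes T :: "(real ^ 'n) set"
  assumes "subspace T"
  shows "\<exists>!y. y \<in> T \<and> x - y \<in> T\<^sup>\<bottom>"
proof (rule ex_ex1I)
  obtain y z where "y \<in> T" "z \<in> T\<^sup>\<bottom>" "x = y + z"
    using subspace_sum_orthogonal_comp[OF assms] set_plus_elim by (metis UNIV_I)
  then show "\<exists>y. y \<in> T \<and> x - y \<in> T\<^sup>\<bottom>"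
    by (intro exI[of _ y]) simp
next
  fix y z
  assume y: "y \<in> T \<and> x - y \<in> T\<^sup>\<bottom>" and z: "z \<in> T \<and> x - z \<in> T\<^sup>\<bottom>"
  then have "y - z \<in> T"
    using assms subspace_diff by blast
  moreover have "(x - z) - (x - y) \<in> T\<^sup>\<bottom>"
    using y z subspace_diff subspace_orthogonal_comp by blast
  then have "y - z \<in> T\<^sup>\<bottom>"
    by simp
  ultimately have "orthogonal (y - z) (y - z)"
    by (simp add: orthogonal_comp_def)
  then show "y = z"
    by (simp add: orthogonal_self)
qed

text \<open>The sum of subspaces is the elementwise sum of sets from \<^theory>\<open>HOL-Library.Set_Algebras\<close>.
  For subspaces of the spans of the parts of an orthonormal basis it is automatically direct.\<close>

lemma direct_sum_of_parts:
  fixes V :: "(real ^ 'n) set"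
  assumes V: "orthonormal_basis V" and P: "partition_of V M P"
    and sub: "\<And>j. j \<in> {1..M} \<Longrightarrow> F j \<subseteq> span (P j)"
    and y: "\<And>j. j \<in> {1..M} \<Longrightarrow> y j \<in> F j" and s: "(\<Sum>j=1..M. y j) = 0"
    and i: "i \<in> {1..M}"
  shows "y i = 0"
proof -
  have orth: "y i \<bullet> y j = 0" if j: "j \<in> {1..M}" "j \<noteq> i" for j
  proof -
    have "orthogonal a b" if "a \<in> P i" "b \<in> P j" for a b
    proof -
      have "a \<in> V" "b \<in> V" "a \<noteq> b"
        using P i j that unfolding partition_of_def disjoint_family_on_def by blast+
      then show ?thesis
        using V unfolding orthonormal_basis_def pairwise_def by blast
    qed
    then have "orthogonal a b" if "a \<in> span (P i)" "b \<in> span (P j)" for a b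
      using that by (meson orthogonal_commute orthogonal_to_span)
    then show ?thesis
      using sub y i j unfolding orthogonal_def by blast
  qed
  have "0 = y i \<bullet> (\<Sum>j=1..M. y j)"
    using s by simp
  also have "\<dots> = (\<Sum>j=1..M. if j = i then y i \<bullet> y i else 0)"
    unfolding inner_sum_right by (rule sum.cong) (auto simp: orth)
  also have "\<dots> = y i \<bullet> y i"
    using i by simp
  finally show ?thesis
    by simp
qed

end

theory Submission
  imports Defs
begin

text \<open>
  Write \<open>x = \<Sum>j. x j\<close> with \<open>x j \<in> span (P j)\<close>.  The spans of the parts are mutually orthogonal and
  \<open>\<Phi> j\<close> lies in \<open>span (P j)\<close>, so projecting onto the sum of the \<open>\<Phi> j\<close> amounts to projecting each
  \<open>x j\<close> onto \<open>\<Phi> j\<close> separately (\<open>orth_proj_sum\<close>), and the error satisfies Pythagoras' theorem: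
  its square is the sum of the squares of the local errors, at most
  \<open>\<epsilon>\<^sup>2 * (\<Sum>j. x j \<bullet> (A\<^sub>j *v x j))\<close>, where \<open>A\<^sub>j\<close> is the interior energy of \<open>P j\<close>.

  What remains is that interior energies never add up to more than \<open>A\<close>
  (\<open>sum_interior_energy_le\<close>).  A positive semidefinite matrix annihilates every vector on which
  its quadratic form vanishes, so an energy \<open>E k\<close> with neighbours only in \<open>P j\<close> annihilates the
  span of every other part.  Hence it sees only the component \<open>x j\<close> of \<open>x\<close>, contributes to the
  local energies exactly \<open>x \<bullet> (E k *v x)\<close>, and does so once.  The energies interior to no part
  contribute nothing locally and something nonnegative to \<open>A\<close>.
\<close>

section \<open>Positive semidefinite matrices\<close>

lemma inner_symmetric_matrix:
  fixes B :: "real ^ 'n ^ 'n"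
  assumes "transpose B = B"
  shows "x \<bullet> (B *v y) = (B *v x) \<bullet> y"
  by (metis assms dot_lmul_matrix transpose_matrix_vector)

text \<open>Moving from \<open>x\<close> a little against the gradient \<open>B *v x\<close> would make the form negative,
  unless this gradient (up to a factor 2) is zero.\<close>

lemma sym_psd_null_vector:
  fixes B :: "real ^ 'n ^ 'n"
  assumes B: "sym_psd B" and x: "x \<bullet> (B *v x) = 0"
  shows "B *v x = 0"
proof -
  define y where "y = B *v x"
  define c where "c = y \<bullet> y"
  define d where "d = y \<bullet> (B *v y)"
  have d: "d \<ge> 0"
    using B by (simp add: sym_psd_def d_def)
  have xy: "x \<bullet> (B *v y) = c"
    using inner_symmetric_matrix[of B x y] B by (simp add: sym_psd_def c_def y_def)
  have nonneg: "2 * t * c + t\<^sup>2 * d \<ge> 0" for t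
  proof -
    have "(x + t *\<^sub>R y) \<bullet> (B *v (x + t *\<^sub>R y)) = 2 * t * c + t\<^sup>2 * d"
      using x xy
      by (simp add: matrix_vector_right_distrib matrix_vector_mult_scaleR inner_add_left
          inner_add_right c_def d_def y_def[symmetric] power2_eq_square algebra_simps)
    then show ?thesis
      using B by (metis sym_psd_def)
  qed
  \<comment> \<open>The minimiser \<open>- c / d\<close>, shifted so that \<open>d = 0\<close> needs no separate treatment.\<close>
  define t where "t = - c / (d + 1)"
  have c: "c = - t * (d + 1)"
    using d by (simp add: t_def)
  have "2 * t * c + t\<^sup>2 * d = - (t\<^sup>2 * (d + 2))"
    by (simp add: c power2_eq_square algebra_simps)
  then have "t\<^sup>2 * (d + 2) \<le> 0"
    using nonneg[of t] by linarith
  then have "c = 0"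
    using d by (auto simp: c mult_le_0_iff)
  then show ?thesis
    by (simp add: c_def y_def)
qed

lemma sym_psd_sum:
  fixes F :: "'i \<Rightarrow> real ^ 'n ^ 'n"
  assumes "\<And>i. i \<in> I \<Longrightarrow> sym_psd (F i)"
  shows "sym_psd (\<Sum>i\<in>I. F i)"
  using assms
proof (induction I rule: infinite_finite_induct)
  case (insert i I)
  then show ?case
    by (auto simp: sym_psd_def matrix_vector_mult_add_rdistrib inner_add_right transpose_def vec_eq_iff)
qed (auto simp: sym_psd_def transpose_def vec_eq_iff)

lemma quadratic_form_sum:
  fixes F :: "'i \<Rightarrow> real ^ 'n ^ 'n"
  assumes "finite I"
  shows "x \<bullet> ((\<Sum>i\<in>I. F i) *v x) = (\<Sum>i\<in>I. x \<bullet> (F i *v x))"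
  using assms
  by (induction I rule: finite_induct) (auto simp: matrix_vector_mult_add_rdistrib inner_add_right)

lemma energy_norm_power2:
  assumes "sym_psd B"
  shows "(energy_norm B x)\<^sup>2 = x \<bullet> (B *v x)"
  using assms by (simp add: sym_psd_def energy_norm_def)

section \<open>Orthogonal sums of subspaces\<close>

lemma orth_proj_eqI:
  fixes x y :: "real ^ 'n"
  assumes "y \<in> T" and "x - y \<in> T\<^sup>\<bottom>"
  shows "orth_proj T x = y"
  unfolding orth_proj_def
proof (rule the_equality)
  fix z
  assume z: "z \<in> T \<and> x - z \<in> T\<^sup>\<bottom>"
  then have "z \<bullet> (x - y) = 0" "z \<bullet> (x - z) = 0" "y \<bullet> (x - y) = 0" "y \<bullet> (x - z) = 0"
    using assms by (auto simp: orthogonal_comp_def orthogonal_def)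
  then have "(z - y) \<bullet> (z - y) = 0"
    by (simp add: inner_diff_left inner_diff_right inner_commute)
  then show "z = y"
    by simp
qed (use assms in auto)

lemma orth_proj_props:
  assumes "subspace T"
  shows "orth_proj T x \<in> T" and "x - orth_proj T x \<in> T\<^sup>\<bottom>"
  using theI'[OF orth_proj_ex1[OF assms, of x]] unfolding orth_proj_def by auto

lemma sum_span_eq_span_UN:
  fixes S :: "'i \<Rightarrow> (real ^ 'n) set"
  assumes "finite I"
  shows "(\<Sum>i\<in>I. span (S i)) = span (\<Union>i\<in>I. S i)"
  using assms
  by (induction I rule: finite_induct) (auto simp: span_Un set_plus_def)

lemma orthogonal_spans_of_parts:
  assumes V: "orthonormal_basis V" and P: "partition_of V M P"
    and ij: "i \<in> {1..M}" "j \<in> {1..M}" "i \<noteq> j"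
    and a: "a \<in> span (P i)" and b: "b \<in> span (P j)"
  shows "orthogonal a b"
proof -
  have "orthogonal u w" if "u \<in> P i" "w \<in> P j" for u w
  proof -
    have "u \<in> V" "w \<in> V" "u \<noteq> w"
      using P ij that unfolding partition_of_def disjoint_family_on_def by blast+
    then show ?thesis
      using V unfolding orthonormal_basis_def pairwise_def by blast
  qed
  then show ?thesis
    using a b by (meson orthogonal_commute orthogonal_to_span)
qed

text \<open>The residual of each \<open>x j\<close> is orthogonal to \<open>\<Phi> j\<close> by projection and to every other \<open>\<Phi> i\<close>
  because it stays in \<open>W j\<close>.\<close>

lemma orth_proj_sum:
  fixes W \<Phi> :: "'i \<Rightarrow> (real ^ 'n) set"
  assumes fin: "finite I"
    and orth: "\<And>i j a b. i \<in> I \<Longrightarrow> j \<in> I \<Longrightarrow> i \<noteq> j \<Longrightarrow> a \<in> W i \<Longrightarrow> b \<in> W j \<Longrightarrow> orthogonal a b"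
    and W: "\<And>j. j \<in> I \<Longrightarrow> subspace (W j)"
    and \<Phi>: "\<And>j. j \<in> I \<Longrightarrow> subspace (\<Phi> j)" "\<And>j. j \<in> I \<Longrightarrow> \<Phi> j \<subseteq> W j"
    and x: "\<And>j. j \<in> I \<Longrightarrow> x j \<in> W j"
  shows "orth_proj (\<Sum>j\<in>I. \<Phi> j) (\<Sum>j\<in>I. x j) = (\<Sum>j\<in>I. orth_proj (\<Phi> j) (x j))"
proof (rule orth_proj_eqI)
  show "(\<Sum>j\<in>I. orth_proj (\<Phi> j) (x j)) \<in> (\<Sum>j\<in>I. \<Phi> j)"
    using orth_proj_props(1) \<Phi> by (auto simp: set_sum_alt[OF fin])
  have res: "orthogonal a (x j - orth_proj (\<Phi> j) (x j))" if "i \<in> I" "j \<in> I" "a \<in> \<Phi> i" for i j a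
  proof (cases "i = j")
    case True
    then show ?thesis
      using orth_proj_props(2)[OF \<Phi>(1), of j "x j"] that by (auto simp: orthogonal_comp_def)
  next
    case False
    have "x j - orth_proj (\<Phi> j) (x j) \<in> W j"
      using that W \<Phi> x orth_proj_props(1) by (meson subsetD subspace_diff)
    then show ?thesis
      using orth False that \<Phi> by blast
  qed
  show "(\<Sum>j\<in>I. x j) - (\<Sum>j\<in>I. orth_proj (\<Phi> j) (x j)) \<in> (\<Sum>j\<in>I. \<Phi> j)\<^sup>\<bottom>"
    unfolding orthogonal_comp_def sum_subtractf[symmetric] set_sum_alt[OF fin]
    using res by (auto simp: orthogonal_def inner_sum_left inner_sum_right)
qed

section \<open>Interior energies\<close>

lemma matrix_vector_mult_zero_on_span:
  fixes B :: "real ^ 'n ^ 'n"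
  assumes "\<And>v. v \<in> S \<Longrightarrow> B *v v = 0" and "x \<in> span S"
  shows "B *v x = 0"
  using linear_eq_0_on_span[OF matrix_vector_mul_linear assms(1) assms(2)] by blast

lemma sym_psd_zero_on_span_non_neighbours:
  assumes B: "sym_psd B" and "S \<subseteq> V - neighbours B V" and "x \<in> span S"
  shows "B *v x = 0"
proof (rule matrix_vector_mult_zero_on_span[OF _ assms(3)])
  fix v
  assume "v \<in> S"
  then have "\<not> touches B v"
    using assms(2) by (auto simp: neighbours_def)
  then have "v \<bullet> (B *v v) = 0"
    using B by (simp add: touches_def sym_psd_def order.antisym not_less)
  then show "B *v v = 0"
    by (rule sym_psd_null_vector[OF B])
qed

text \<open>If some part contains all neighbours of \<open>B\<close>, then \<open>B\<close> annihilates the components of \<open>x\<close> in all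
  the other parts.  So the left-hand side has at most one nonzero term, even in the degenerate case
  \<open>B = 0\<close>, where \<open>B\<close> is interior to every part.\<close>

lemma local_energies_le:
  assumes B: "sym_psd B" and P: "partition_of V M P"
    and x: "\<And>j. j \<in> {1..M} \<Longrightarrow> x j \<in> span (P j)"
  shows "(\<Sum>j\<in>{j\<in>{1..M}. neighbours B V \<subseteq> P j}. x j \<bullet> (B *v x j))
           \<le> (\<Sum>j=1..M. x j) \<bullet> (B *v (\<Sum>j=1..M. x j))"
proof (cases "\<exists>i\<in>{1..M}. neighbours B V \<subseteq> P i")
  case False
  then have none: "{j\<in>{1..M}. neighbours B V \<subseteq> P j} = {}"
    by blast
  show ?thesis
    using B unfolding none by (simp add: sym_psd_def)
next
  case True
  then obtain i where i: "i \<in> {1..M}" "neighbours B V \<subseteq> P i"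
    by blast
  have zero: "B *v x j = 0" if j: "j \<in> {1..M}" "j \<noteq> i" for j
  proof (rule sym_psd_zero_on_span_non_neighbours[OF B _ x])
    show "P j \<subseteq> V - neighbours B V"
      using P i j unfolding partition_of_def disjoint_family_on_def by blast
  qed (use j in auto)
  define X where "X = (\<Sum>j=1..M. x j)"
  have "B *v X = (\<Sum>j=1..M. B *v x j)"
    by (simp add: X_def linear_sum[OF matrix_vector_mul_linear])
  also have "\<dots> = (\<Sum>j=1..M. if j = i then B *v x i else 0)"
    by (rule sum.cong) (auto simp: zero)
  also have "\<dots> = B *v x i"
    using i by simp
  finally have BX: "B *v X = B *v x i" .
  have "(\<Sum>j\<in>{j\<in>{1..M}. neighbours B V \<subseteq> P j}. x j \<bullet> (B *v x j)) = (\<Sum>j\<in>{i}. x j \<bullet> (B *v x j))"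
    by (rule sum.mono_neutral_right) (use i zero in auto)
  also have "\<dots> = (B *v X) \<bullet> x i"
    by (simp add: BX inner_commute)
  also have "\<dots> = X \<bullet> (B *v X)"
    using B inner_symmetric_matrix[of B X "x i"] by (simp add: sym_psd_def BX)
  finally show ?thesis
    by (simp add: X_def)
qed

text \<open>Exchanging the sums over parts and over energies reduces the claim to a single energy.\<close>

lemma sum_interior_energy_le:
  assumes E: "energy_decomposition A m E" and P: "partition_of V M P"
    and x: "\<And>j. j \<in> {1..M} \<Longrightarrow> x j \<in> span (P j)"
  shows "(\<Sum>j=1..M. x j \<bullet> (interior_energy m E V (P j) *v x j))
           \<le> (\<Sum>j=1..M. x j) \<bullet> (A *v (\<Sum>j=1..M. x j))"
proof -
  have "(\<Sum>j=1..M. x j \<bullet> (interior_energy m E V (P j) *v x j))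
      = (\<Sum>j=1..M. \<Sum>k\<in>{k\<in>{1..m}. neighbours (E k) V \<subseteq> P j}. x j \<bullet> (E k *v x j))"
    by (simp add: interior_energy_def quadratic_form_sum)
  also have "\<dots> = (\<Sum>k=1..m. \<Sum>j\<in>{j\<in>{1..M}. neighbours (E k) V \<subseteq> P j}. x j \<bullet> (E k *v x j))"
    by (rule sum.swap_restrict) auto
  also have "\<dots> \<le> (\<Sum>k=1..m. (\<Sum>j=1..M. x j) \<bullet> (E k *v (\<Sum>j=1..M. x j)))"
    using E by (intro sum_mono local_energies_le[OF _ P x]) (auto simp: energy_decomposition_def)
  also have "\<dots> = (\<Sum>j=1..M. x j) \<bullet> (A *v (\<Sum>j=1..M. x j))"
    using E by (simp add: energy_decomposition_def quadratic_form_sum)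
  finally show ?thesis .
qed

section \<open>From local to global projection errors\<close>

theorem proposition3p2:
  fixes A :: "real ^ 'n ^ 'n"
    and E :: "nat \<Rightarrow> real ^ 'n ^ 'n"
    and V :: "(real ^ 'n) set"
    and P \<Phi> :: "nat \<Rightarrow> (real ^ 'n) set"
    and m M :: nat
    and \<epsilon> :: real
  assumes "sym_pd A"
    and "energy_decomposition A m E"
    and "orthonormal_basis V"
    and "partition_of V M P"
    and "\<epsilon> \<ge> 0"
    and "\<And>j. j \<in> {1..M} \<Longrightarrow> subspace (\<Phi> j) \<and> \<Phi> j \<subseteq> span (P j)"
    and "\<And>j x. j \<in> {1..M} \<Longrightarrow> x \<in> span (P j) \<Longrightarrow>
           norm (x - orth_proj (\<Phi> j) x) \<le> \<epsilon> * energy_norm (interior_energy m E V (P j)) x"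
  shows "\<forall>x. norm (x - orth_proj (\<Sum>j=1..M. \<Phi> j) x) \<le> \<epsilon> * energy_norm A x"
proof
  fix x :: "real ^ 'n"
  note E = assms(2) and V = assms(3) and P = assms(4) and \<Phi> = assms(6) and loc = assms(7)
  let ?B = "\<lambda>j. interior_energy m E V (P j)"
  have psd: "sym_psd (E k)" if "k \<in> {1..m}" for k
    using E that by (simp add: energy_decomposition_def)
  have A_psd: "sym_psd A"
    using E psd sym_psd_sum[of "{1..m}" E] by (simp add: energy_decomposition_def)
  have B_psd: "sym_psd (?B j)" for j
    unfolding interior_energy_def by (rule sym_psd_sum) (use psd in auto)
  have "x \<in> (\<Sum>j=1..M. span (P j))"
    using V P by (simp add: sum_span_eq_span_UN partition_of_def orthonormal_basis_def)
  then obtain y where y: "\<And>j. j \<in> {1..M} \<Longrightarrow> y j \<in> span (P j)" and xy: "x = (\<Sum>j=1..M. y j)"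
    unfolding set_sum_alt[OF finite_atLeastAtMost] by blast
  define r where "r j = y j - orth_proj (\<Phi> j) (y j)" for j
  have r_span: "r j \<in> span (P j)" if "j \<in> {1..M}" for j
    unfolding r_def using that y \<Phi> orth_proj_props(1) by (meson span_diff subsetD)
  have "x - orth_proj (\<Sum>j=1..M. \<Phi> j) x = (\<Sum>j=1..M. r j)"
    unfolding xy r_def sum_subtractf
    using orth_proj_sum[of "{1..M}" "\<lambda>j. span (P j)" \<Phi> y] orthogonal_spans_of_parts[OF V P] \<Phi> y
    by simp
  then have "(norm (x - orth_proj (\<Sum>j=1..M. \<Phi> j) x))\<^sup>2 = (\<Sum>j=1..M. (norm (r j))\<^sup>2)"
    using orthogonal_spans_of_parts[OF V P] r_span
    by (simp add: norm_sum_Pythagorean pairwise_def)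
  also have "\<dots> \<le> (\<Sum>j=1..M. (\<epsilon> * energy_norm (?B j) (y j))\<^sup>2)"
    unfolding r_def by (intro sum_mono power_mono loc y) auto
  also have "\<dots> = \<epsilon>\<^sup>2 * (\<Sum>j=1..M. y j \<bullet> (?B j *v y j))"
    by (simp add: power_mult_distrib sum_distrib_left energy_norm_power2[OF B_psd])
  also have "\<dots> \<le> \<epsilon>\<^sup>2 * (x \<bullet> (A *v x))"
    unfolding xy by (intro mult_left_mono sum_interior_energy_le[OF E P y]) auto
  also have "\<dots> = (\<epsilon> * energy_norm A x)\<^sup>2"
    by (simp add: power_mult_distrib energy_norm_power2[OF A_psd])
  finally show "norm (x - orth_proj (\<Sum>j=1..M. \<Phi> j) x) \<le> \<epsilon> * energy_norm A x"
    using \<open>\<epsilon> \<ge> 0\<close> A_psd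
    by (auto intro!: power2_le_imp_le mult_nonneg_nonneg simp: energy_norm_def sym_psd_def)
qed

end
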